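(* For every instance of the problem $F2\,|\,p_j=1,\,CD\,|\,C_{\max}$ in which each operation performed on the first machine is linked by precedence relations with exactly two operations performed on the second machine (i.e. $|S_i|=2$ for all $i=1,\ldots,n$), algorithm $PD_2$ finds an optimal schedule.
   Context: Problem $F2\,|\,p_j=1,\,CD\,|\,C_{\max}$. There are operations $V_1=\{A_1,\ldots,A_n\}$, performed on machine $M_1$, and $V_2=\{B_1,\ldots,B_m\}$, performed on machine $M_2$ ($n,m\ge 1$). Every operation has duration $1$. Preemption is not allowed, and a machine cannot perform two operations at the same time. Precedence is given by a directed bipartite graph $G=(V_1\cup V_2,E)$, where an arc $(A_i,B_j)\in E$ means that $B_j$ cannot start before $A_i$ is completed. A schedule is given by start times $s_i^A\ge 0$ of $A_i$ and $s_j^B\ge 0$ of $B_j$; it is feasible if, in addition to the machine constraints, every $B_j$ starts no earlier than the completion of all $A_i$ with $(A_i,B_j)\in E$. The length of a schedule is $C_{\max}=\max\{\max_i (s_i^A+1),\max_j (s_j^B+1)\}$, and an optimal schedule is a feasible schedule of minimum length. Let $S_i$ be the set of operations $B_j$ with $(A_i,B_j)\in E$, $T_j$ the set of operations $A_i$ with $(A_i,B_j)\in E$, and $d_j^B=|T_j|$. Algorithm $PD_2$. The sets $V_2$, $T_j$ and the values $d_j^B=|T_j|$ are updated during the run. While $V_2\neq\emptyset$, repeat: Step 1. Order the current set $V_2$ by non-decreasing $d_j^B$: $d_{l_1}^B\le d_{l_2}^B\le\ldots\le d_{l_k}^B$, $k=|V_2|$ (ties broken arbitrarily). Let $B_{l_1},\ldots,B_{l_r}$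 ($r\ge 0$) be all the operations with currently empty $T_{l_j}$. Perform them in arbitrary order on $M_2$ starting at the moment $M_2$ becomes free (at time $0$ if nothing has yet been scheduled on $M_2$), and delete them from $V_2$. Step 2 (if $V_2$ is still nonempty). At the moment $M_1$ becomes free, perform on $M_1$, consecutively without idle time and in any order, the $d_{l_{r+1}}^B$ operations of the current set $T_{l_{r+1}}$. Delete these vertices from the graph together with all arcs leaving them. Perform $B_{l_{r+1}}$ on $M_2$, after the operations already scheduled there, at the earliest time satisfying feasibility, and delete it from $V_2$. Update $T_j$ and $d_j^B$ for the remaining $B_j\in V_2$. *)

theory Defs
  imports Complex_Main
begin

type_synonym ('a, 'b) arcs = "('a \<times> 'b) set"

definition S_of :: "('a, 'b) arcs \<Rightarrow> 'a \<Rightarrow> 'b set" where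
  "S_of E a = {b. (a, b) \<in> E}"

definition T_of :: "('a, 'b) arcs \<Rightarrow> 'b \<Rightarrow> 'a set" where
  "T_of E b = {a. (a, b) \<in> E}"

definition F2CD_instance :: "'a set \<Rightarrow> 'b set \<Rightarrow> ('a, 'b) arcs \<Rightarrow> bool" where
  "F2CD_instance V1 V2 E \<longleftrightarrow>
     finite V1 \<and> V1 \<noteq> {} \<and> finite V2 \<and> V2 \<noteq> {} \<and> E \<subseteq> V1 \<times> V2"


text \<open>Start times are reals. They are total functions of which only the values on \<open>V1\<close> and
  \<open>V2\<close> matter.\<close>

definition no_overlap :: "'x set \<Rightarrow> ('x \<Rightarrow> real) \<Rightarrow> bool" where
  "no_overlap V s \<longleftrightarrow> (\<forall>x\<in>V. \<forall>y\<in>V. x \<noteq> y \<longrightarrow> s x + 1 \<le> s y \<or> s y + 1 \<le> s x)"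

definition feasible ::
  "'a set \<Rightarrow> 'b set \<Rightarrow> ('a, 'b) arcs \<Rightarrow> ('a \<Rightarrow> real) \<Rightarrow> ('b \<Rightarrow> real) \<Rightarrow> bool" where
  "feasible V1 V2 E sA sB \<longleftrightarrow>
     (\<forall>a\<in>V1. 0 \<le> sA a) \<and> (\<forall>b\<in>V2. 0 \<le> sB b) \<and>
     no_overlap V1 sA \<and> no_overlap V2 sB \<and>
     (\<forall>(a, b)\<in>E. sA a + 1 \<le> sB b)"

definition Cmax :: "'a set \<Rightarrow> 'b set \<Rightarrow> ('a \<Rightarrow> real) \<Rightarrow> ('b \<Rightarrow> real) \<Rightarrow> real" where
  "Cmax V1 V2 sA sB = max (Max ((\<lambda>a. sA a + 1) ` V1)) (Max ((\<lambda>b. sB b + 1) ` V2))"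

definition optimal ::
  "'a set \<Rightarrow> 'b set \<Rightarrow> ('a, 'b) arcs \<Rightarrow> ('a \<Rightarrow> real) \<Rightarrow> ('b \<Rightarrow> real) \<Rightarrow> bool" where
  "optimal V1 V2 E sA sB \<longleftrightarrow>
     feasible V1 V2 E sA sB \<and>
     (\<forall>sA' sB'. feasible V1 V2 E sA' sB' \<longrightarrow> Cmax V1 V2 sA sB \<le> Cmax V1 V2 sA' sB')"


text \<open>A state of the algorithm holds the current set of second-machine operations, the current arcs
  (so that the current sets of predecessors are \<open>T_of (arcs st) b\<close>), the moments at which the two
  machines become free, and the partial schedule built so far.\<close>

record ('a, 'b) pd2_state =
  todo :: "'b set"
  arcs :: "('a, 'b) arcs"
  free1 :: real
  free2 :: real
  startA :: "'a \<rightharpoonup> real"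
  startB :: "'b \<rightharpoonup> real"

definition pd2_init :: "'b set \<Rightarrow> ('a, 'b) arcs \<Rightarrow> ('a, 'b) pd2_state" where
  "pd2_init V2 E = \<lparr>todo = V2, arcs = E, free1 = 0, free2 = 0,
     startA = Map.empty, startB = Map.empty\<rparr>"

fun consecutively :: "real \<Rightarrow> 'x list \<Rightarrow> ('x \<rightharpoonup> real) \<Rightarrow> ('x \<rightharpoonup> real)" where
  "consecutively t [] s = s"
| "consecutively t (x # xs) s = consecutively (t + 1) xs (s(x \<mapsto> t))"

definition lists_of :: "'x set \<Rightarrow> 'x list set" where
  "lists_of X = {xs. distinct xs \<and> set xs = X}"

definition degree_ordering :: "('a, 'b) pd2_state \<Rightarrow> 'b list \<Rightarrow> bool" where
  "degree_ordering st ls \<longleftrightarrow>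
     ls \<in> lists_of (todo st) \<and> sorted (map (\<lambda>b. card (T_of (arcs st) b)) ls)"

definition num_ready :: "('a, 'b) pd2_state \<Rightarrow> nat" where
  "num_ready st = card {b \<in> todo st. T_of (arcs st) b = {}}"

definition pd2_step1 ::
  "'b set \<Rightarrow> ('a, 'b) pd2_state \<Rightarrow> ('a, 'b) pd2_state \<Rightarrow> bool" where
  "pd2_step1 R st st' \<longleftrightarrow>
     (\<exists>bs \<in> lists_of R. st' = st\<lparr>
        todo := todo st - R,
        free2 := free2 st + real (length bs),
        startB := consecutively (free2 st) bs (startB st)\<rparr>)"

text \<open>In \<open>pd2_step2\<close> the set \<open>E\<close> is the original set of arcs: feasibility of the start time \<open>t\<close>
  concerns all predecessors of \<open>b\<close>, including those that were performed, and deleted from the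
  graph, in earlier iterations.\<close>

definition pd2_step2 ::
  "('a, 'b) arcs \<Rightarrow> 'b \<Rightarrow> ('a, 'b) pd2_state \<Rightarrow> ('a, 'b) pd2_state \<Rightarrow> bool" where
  "pd2_step2 E b st st' \<longleftrightarrow>
     (\<exists>as \<in> lists_of (T_of (arcs st) b).
        let sA = consecutively (free1 st) as (startA st);
            t = Max (insert (free2 st) ((\<lambda>a. the (sA a) + 1) ` T_of E b))
        in st' = \<lparr>
             todo = todo st - {b},
             arcs = {(a, b') \<in> arcs st. a \<notin> set as},
             free1 = free1 st + real (length as),
             free2 = t + 1,
             startA = sA,
             startB = (startB st)(b \<mapsto> t)\<rparr>)"

text \<open>One pass through the body of the while loop. List indices start at \<open>0\<close>, so \<open>ls ! r\<close> is the
  operation in position \<open>r + 1\<close>. The ordering, the order of the ready operations and the order of the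
  predecessors are all arbitrary, hence the relation.\<close>

definition pd2_iteration ::
  "('a, 'b) arcs \<Rightarrow> ('a, 'b) pd2_state \<Rightarrow> ('a, 'b) pd2_state \<Rightarrow> bool" where
  "pd2_iteration E st st' \<longleftrightarrow>
     todo st \<noteq> {} \<and>
     (\<exists>ls st1. degree_ordering st ls \<and>
        (let r = num_ready st in
           pd2_step1 (set (take r ls)) st st1 \<and>
           (if todo st1 = {} then st' = st1 else pd2_step2 E (ls ! r) st1 st')))"

definition pd2_reachable :: "'b set \<Rightarrow> ('a, 'b) arcs \<Rightarrow> ('a, 'b) pd2_state \<Rightarrow> bool" where
  "pd2_reachable V2 E st \<longleftrightarrow> (pd2_iteration E)\<^sup>*\<^sup>* (pd2_init V2 E) st"

text \<open>The algorithm finds an optimal schedule if, whatever arbitrary choices are made, every run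
  terminates, no run gets stuck before the current set of second-machine operations is empty, and the
  final schedule is complete and optimal.\<close>

definition pd2_finds_optimal :: "'a set \<Rightarrow> 'b set \<Rightarrow> ('a, 'b) arcs \<Rightarrow> bool" where
  "pd2_finds_optimal V1 V2 E \<longleftrightarrow>
     (\<nexists>run. run 0 = pd2_init V2 E \<and> (\<forall>k::nat. pd2_iteration E (run k) (run (Suc k)))) \<and>
     (\<forall>st. pd2_reachable V2 E st \<and> todo st \<noteq> {} \<longrightarrow> (\<exists>st'. pd2_iteration E st st')) \<and>
     (\<forall>st. pd2_reachable V2 E st \<and> todo st = {} \<longrightarrow>
        dom (startA st) = V1 \<and> dom (startB st) = V2 \<and>
        optimal V1 V2 E (the \<circ> startA st) (the \<circ> startB st))"

end

(* View each A as an edge joining its two successors, so that the B's are the vertices of a multigraph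
   and the algorithm repeatedly removes a vertex of minimum degree.  Every schedule has length at
   least n + 2, since both successors of the last A start at time n or later, at least m, and at least
   m + 1 if no vertex is isolated.  Let Q edges and R vertices remain before a vertex of minimum
   degree d \<ge> 1 is removed.  If M2 has to wait for M1, all remaining operations on M2 can still be
   finished by time (n - Q) + d + R.  If d \<ge> 2, counting incidences gives 2 Q \<ge> d R, and
   (d - 2) (R - 2) \<ge> 0 turns this into (n - Q) + d + R \<le> n + 2.  If d = 1, the bound
   reads (n - Q) + R + 1; this quantity is at most m + 1 at the start, at most m once an isolated
   vertex is gone, and when a vertex of degree d is removed its new value is the old (n - Q) + d + R. *)

theory Submission
  imports Defs
begin

section \<open>Lower bounds\<close>

text \<open>Induction on the number of operations: the one that starts last has to wait for all the
  others, one of which already ends at \<open>c + k\<close> or later. A singleton is treated apart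
  because the induction hypothesis needs a nonempty rest.\<close>

lemma no_overlap_late:
  assumes "finite V" "V \<noteq> {}" "no_overlap V s" "\<And>x. x \<in> V \<Longrightarrow> c \<le> s x"
  shows "\<exists>x\<in>V. c + real (card V) \<le> s x + 1"
  using assms
proof (induction "card V" arbitrary: V)
  case 0
  then show ?case by simp
next
  case (Suc k)
  obtain x where x: "x \<in> V" "\<And>y. y \<in> V \<Longrightarrow> s y \<le> s x"
    using Max_in[of "s ` V"] Max_ge[of "s ` V"] Suc.prems(1,2) by fastforce
  show ?case
  proof (cases "V = {x}")
    case True
    then show ?thesis using Suc.prems(4) by simp
  next
    case False
    have card: "card (V - {x}) = k" using Suc.hyps(2) x(1) Suc.prems(1) by simp
    have "\<exists>y\<in>V - {x}. c + real (card (V - {x})) \<le> s y + 1"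
      by (rule Suc.hyps(1)) (use card False x(1) Suc.prems in \<open>auto simp: no_overlap_def\<close>)
    then obtain y where y: "y \<in> V" "y \<noteq> x" "c + real k \<le> s y + 1"
      using card by auto
    have "s x + 1 \<le> s y \<or> s y + 1 \<le> s x"
      using x(1) y Suc.prems(3) unfolding no_overlap_def by blast
    then have "s y + 1 \<le> s x" using x(2)[OF y(1)] by linarith
    then show ?thesis using y(3) x(1) Suc.hyps(2) by (intro bexI[of _ x]) auto
  qed
qed

lemma Cmax_ge_B:
  assumes "finite V2" "b \<in> V2"
  shows "sB b + 1 \<le> Cmax V1 V2 sA sB"
proof -
  have "sB b + 1 \<le> Max ((\<lambda>b. sB b + 1) ` V2)"
    using assms by (intro Max_ge) auto
  then show ?thesis unfolding Cmax_def by simp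
qed

lemma Cmax_ge_B_late:
  assumes "finite V2" "no_overlap V2 sB" "V \<subseteq> V2" "V \<noteq> {}" "\<And>b. b \<in> V \<Longrightarrow> c \<le> sB b"
  shows "c + real (card V) \<le> Cmax V1 V2 sA sB"
proof -
  have "no_overlap V sB" using assms(2,3) unfolding no_overlap_def by blast
  then obtain b where "b \<in> V" "c + real (card V) \<le> sB b + 1"
    using no_overlap_late[of V sB c] assms finite_subset by blast
  then show ?thesis using Cmax_ge_B[of V2 b sB V1 sA] assms by (meson order_trans subsetD)
qed

text \<open>Some A ends at time \<open>card V1\<close> or later; after that moment M2 still has to
  perform both of its successors, one after the other.\<close>

lemma Cmax_ge_card_A:
  assumes "F2CD_instance V1 V2 E" "\<forall>a\<in>V1. card (S_of E a) = 2" "feasible V1 V2 E sA sB"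
  shows "real (card V1) + 2 \<le> Cmax V1 V2 sA sB"
proof -
  obtain a where a: "a \<in> V1" "0 + real (card V1) \<le> sA a + 1"
    using no_overlap_late[of V1 sA 0] assms unfolding F2CD_instance_def feasible_def by blast
  have "card (S_of E a) = 2" using assms(2) a(1) by blast
  moreover have "S_of E a \<subseteq> V2" "\<And>b. b \<in> S_of E a \<Longrightarrow> sA a + 1 \<le> sB b"
    using assms(1,3) unfolding F2CD_instance_def feasible_def S_of_def by auto
  ultimately show ?thesis
    using Cmax_ge_B_late[of V2 sB "S_of E a" "real (card V1)" V1 sA] assms(1,3) a(2)
    unfolding F2CD_instance_def feasible_def by fastforce
qed

text \<open>The \<open>of_bool\<close> term is the forced idle unit of M2: if no B is isolated, each
  of them waits for some A and so starts at 1 or later.\<close>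

lemma Cmax_ge_card_B:
  assumes "F2CD_instance V1 V2 E" "feasible V1 V2 E sA sB"
  shows "real (card V2) + of_bool (\<forall>b\<in>V2. T_of E b \<noteq> {}) \<le> Cmax V1 V2 sA sB"
proof -
  have "of_bool (\<forall>b\<in>V2. T_of E b \<noteq> {}) \<le> sB b" if "b \<in> V2" for b
  proof (cases "T_of E b = {}")
    case True
    then show ?thesis using that assms(2) unfolding feasible_def by auto
  next
    case False
    then obtain a where "(a, b) \<in> E" unfolding T_of_def by auto
    moreover from this have "0 \<le> sA a" "sA a + 1 \<le> sB b"
      using assms unfolding F2CD_instance_def feasible_def by auto
    ultimately show ?thesis by simp
  qed
  then show ?thesis
    using Cmax_ge_B_late[of V2 sB V2 "of_bool (\<forall>b\<in>V2. T_of E b \<noteq> {})" V1 sA] assms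
    unfolding F2CD_instance_def feasible_def by (auto simp: add.commute)
qed

text \<open>This turns out to be the optimal length: no feasible schedule is shorter, and every
  completed run meets it. The invariants can thus refer to an explicit number instead of an optimal
  schedule.\<close>

definition pd2_length_bound :: "'a set \<Rightarrow> 'b set \<Rightarrow> ('a \<times> 'b) set \<Rightarrow> real" where
  "pd2_length_bound V1 V2 E =
     max (real (card V1) + 2) (real (card V2) + of_bool (\<forall>b\<in>V2. T_of E b \<noteq> {}))"

lemma Cmax_ge_pd2_length_bound:
  assumes "F2CD_instance V1 V2 E" "\<forall>a\<in>V1. card (S_of E a) = 2" "feasible V1 V2 E sA sB"
  shows "pd2_length_bound V1 V2 E \<le> Cmax V1 V2 sA sB"
  using Cmax_ge_card_A[OF assms] Cmax_ge_card_B[OF assms(1,3)] unfolding pd2_length_bound_def by simp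


section \<open>Partial schedules of one machine\<close>

text \<open>Idle time is allowed: \<open>t\<close> is only a moment from which the machine is free.
  This covers M2, which may have to wait for M1.\<close>

definition packed :: "('x \<rightharpoonup> real) \<Rightarrow> real \<Rightarrow> bool" where
  "packed s t \<longleftrightarrow> 0 \<le> t \<and> (\<forall>x\<in>dom s. 0 \<le> the (s x) \<and> the (s x) + 1 \<le> t) \<and>
     no_overlap (dom s) (the \<circ> s)"

lemma packed_update:
  assumes "packed s t" "x \<notin> dom s" "t \<le> u"
  shows "packed (s(x \<mapsto> u)) (u + 1)"
proof -
  have s: "0 \<le> t" "\<And>y. y \<in> dom s \<Longrightarrow> 0 \<le> the (s y) \<and> the (s y) + 1 \<le> u"
    using assms unfolding packed_def by force+
  have "no_overlap (insert x (dom s)) (the \<circ> s(x \<mapsto> u))"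
    unfolding no_overlap_def
  proof (intro ballI impI)
    fix y z assume "y \<in> insert x (dom s)" "z \<in> insert x (dom s)" "y \<noteq> z"
    then consider "y = x" "z \<in> dom s" "z \<noteq> x" | "z = x" "y \<in> dom s" "y \<noteq> x"
      | "y \<in> dom s" "z \<in> dom s" "y \<noteq> x" "z \<noteq> x" using assms(2) by blast
    then show "(the \<circ> s(x \<mapsto> u)) y + 1 \<le> (the \<circ> s(x \<mapsto> u)) z \<or>
        (the \<circ> s(x \<mapsto> u)) z + 1 \<le> (the \<circ> s(x \<mapsto> u)) y"
    proof cases
      case 3
      then show ?thesis
        using assms(1) \<open>y \<noteq> z\<close> unfolding packed_def no_overlap_def by simp
    qed (use s in auto)
  qed
  moreover have "0 \<le> the ((s(x \<mapsto> u)) y) \<and> the ((s(x \<mapsto> u)) y) + 1 \<le> u + 1"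
    if "y \<in> insert x (dom s)" for y
    using s(2)[of y] that s(1) assms(3) by (cases "y = x") auto
  ultimately show ?thesis using s(1) assms(3) unfolding packed_def by simp
qed

lemma packed_consecutively:
  assumes "packed s t" "distinct xs" "set xs \<inter> dom s = {}"
  shows "packed (consecutively t xs s) (t + real (length xs))"
  using assms
proof (induction xs arbitrary: t s)
  case Nil
  then show ?case by simp
next
  case (Cons x xs)
  have "packed (consecutively (t + 1) xs (s(x \<mapsto> t))) (t + 1 + real (length xs))"
    using Cons.prems by (intro Cons.IH packed_update) (auto split: if_splits)
  then show ?case by (simp add: algebra_simps)
qed

lemma dom_consecutively [simp]: "dom (consecutively t xs s) = dom s \<union> set xs"
  by (induction xs arbitrary: t s) auto

lemma consecutively_other [simp]: "x \<notin> set xs \<Longrightarrow> consecutively t xs s x = s x"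
  by (induction xs arbitrary: t s) auto

lemma consecutively_ge:
  assumes "distinct xs" "x \<in> set xs"
  shows "t \<le> the (consecutively t xs s x)"
  using assms
proof (induction xs arbitrary: t s)
  case Nil
  then show ?case by simp
next
  case (Cons y xs)
  show ?case
  proof (cases "x = y")
    case True
    then show ?thesis using Cons.prems by simp
  next
    case False
    then have "t + 1 \<le> the (consecutively (t + 1) xs (s(y \<mapsto> t)) x)"
      using Cons by auto
    then show ?thesis by simp
  qed
qed

text \<open>The exact completion time is needed to keep \<open>free1 st\<close> \<le>
  \<open>free2 st\<close>: a B that waits for the last operation of a batch starts only when M1 is
  free.\<close>

lemma consecutively_last:
  assumes "distinct xs" "xs \<noteq> []"
  shows "the (consecutively t xs s (last xs)) + 1 = t + real (length xs)"
  using assms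
proof (induction xs arbitrary: t s)
  case Nil
  then show ?case by simp
next
  case (Cons y xs)
  then show ?case by (cases "xs = []") (auto simp: algebra_simps)
qed


section \<open>Degree orderings\<close>

lemma sorted_map_zeros_first:
  fixes f :: "'b \<Rightarrow> nat"
  assumes "sorted (map f ls)"
  shows "ls = filter (\<lambda>b. f b = 0) ls @ filter (\<lambda>b. f b \<noteq> 0) ls"
  using assms
proof (induction ls)
  case Nil
  then show ?case by simp
next
  case (Cons x ls)
  show ?case
  proof (cases "f x = 0")
    case True
    then show ?thesis using Cons by simp
  next
    case False
    then have "\<forall>b\<in>set ls. f b \<noteq> 0" using Cons.prems by auto
    then show ?thesis using False by simp
  qed
qed

text \<open>The algorithm speaks of positions in an ordering, the invariants of sets. The zero keys
  of a sorted list form a prefix, so their number tells how many entries to take.\<close>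

lemma take_zeros:
  fixes f :: "'b \<Rightarrow> nat"
  assumes "sorted (map f ls)" "distinct ls"
  shows "set (take (card {b \<in> set ls. f b = 0}) ls) = {b \<in> set ls. f b = 0}"
proof -
  let ?zs = "filter (\<lambda>b. f b = 0) ls"
  have "card {b \<in> set ls. f b = 0} = length ?zs"
    using distinct_card[of ?zs] assms(2) by simp
  moreover have "take (length ?zs) ls = ?zs"
    by (subst sorted_map_zeros_first[OF assms(1)]) simp
  ultimately show ?thesis by simp
qed

text \<open>Finiteness makes degree 0 mean that no predecessor is left, since \<open>card\<close> is
  also 0 on infinite sets.\<close>

lemma degree_ordering_ready:
  assumes "degree_ordering st ls" "\<And>b. finite (T_of (arcs st) b)"
  shows "set (take (num_ready st) ls) = {b \<in> todo st. T_of (arcs st) b = {}}"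
  using assms take_zeros[of "\<lambda>b. card (T_of (arcs st) b)" ls]
  unfolding degree_ordering_def lists_of_def num_ready_def by simp

text \<open>The ready operations fill exactly the positions before \<open>num_ready st\<close>.
  Hence the operation at that position is not ready, and the other non-ready ones stand further
  right, where degrees are at least as large.\<close>

lemma degree_ordering_next:
  assumes "degree_ordering st ls" "\<And>b. finite (T_of (arcs st) b)"
    and "\<not> todo st \<subseteq> {b \<in> todo st. T_of (arcs st) b = {}}"
  shows "ls ! num_ready st \<in> todo st" "T_of (arcs st) (ls ! num_ready st) \<noteq> {}"
    and "\<And>b. b \<in> todo st \<Longrightarrow> T_of (arcs st) b \<noteq> {} \<Longrightarrow>
      card (T_of (arcs st) (ls ! num_ready st)) \<le> card (T_of (arcs st) b)"
proof -
  let ?r = "num_ready st"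
  have ls: "distinct ls" "set ls = todo st" "sorted (map (\<lambda>b. card (T_of (arcs st) b)) ls)"
    using assms(1) unfolding degree_ordering_def lists_of_def by auto
  note ready = degree_ordering_ready[OF assms(1,2)]
  have r: "?r < length ls"
  proof (rule ccontr)
    assume "\<not> ?r < length ls"
    then have "set (take ?r ls) = todo st" using ls(2) by simp
    then show False using ready assms(3) by blast
  qed
  show todo: "ls ! ?r \<in> todo st" using nth_mem[OF r] unfolding ls(2) .
  have "ls ! ?r \<notin> set (take ?r ls)"
    using ls(1) r by (auto simp: in_set_conv_nth nth_eq_iff_index_eq)
  then show "T_of (arcs st) (ls ! ?r) \<noteq> {}" using todo unfolding ready by blast
  fix b assume b: "b \<in> todo st" "T_of (arcs st) b \<noteq> {}"
  then obtain i where i: "i < length ls" "ls ! i = b" using ls(2) by (metis in_set_conv_nth)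
  have "b \<notin> set (take ?r ls)" unfolding ready using b(2) by blast
  moreover have "b \<in> set (take ?r ls)" if "i < ?r"
    using i that by (auto simp: in_set_conv_nth)
  ultimately have "?r \<le> i" by linarith
  then show "card (T_of (arcs st) (ls ! ?r)) \<le> card (T_of (arcs st) b)"
    using sorted_nth_mono[OF ls(3), of ?r i] i r by simp
qed

lemma ex_degree_ordering:
  assumes "finite (todo st)"
  shows "\<exists>ls. degree_ordering st ls"
proof -
  obtain xs where xs: "set xs = todo st" "distinct xs"
    using finite_distinct_list[OF assms] by blast
  show ?thesis
    by (rule exI[of _ "sort_key (\<lambda>b. card (T_of (arcs st) b)) xs"])
      (use xs in \<open>auto simp: degree_ordering_def lists_of_def\<close>)
qed

lemma lists_of_nonempty: "finite X \<Longrightarrow> \<exists>xs. xs \<in> lists_of X"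
  unfolding lists_of_def using finite_distinct_list by blast


section \<open>Feasibility of the partial schedules\<close>

locale pd2_invar =
  fixes V1 :: "'a set" and V2 :: "'b set" and E :: "('a \<times> 'b) set" and st :: "('a, 'b) pd2_state"
  assumes instance_E: "F2CD_instance V1 V2 E"
    and todo_subset: "todo st \<subseteq> V2"
    and dom_B: "dom (startB st) = V2 - todo st"
    and dom_A: "dom (startA st) \<subseteq> V1"
    and arcs_eq: "arcs st = {(a, b) \<in> E. a \<notin> dom (startA st)}"
    and done_A: "\<And>a b. (a, b) \<in> E \<Longrightarrow> b \<notin> todo st \<Longrightarrow> a \<in> dom (startA st)"
    and free1_eq: "free1 st = real (card (dom (startA st)))"
    and packed_A: "packed (startA st) (free1 st)"
    and packed_B: "packed (startB st) (free2 st)"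
    and free1_le_free2: "free1 st \<le> free2 st"
    and precedence: "\<And>a b. (a, b) \<in> E \<Longrightarrow> b \<in> dom (startB st) \<Longrightarrow>
      the (startA st a) + 1 \<le> the (startB st b)"
begin

lemma finite_V1: "finite V1" and finite_V2: "finite V2" and E_subset: "E \<subseteq> V1 \<times> V2"
  using instance_E unfolding F2CD_instance_def by blast+

lemma T_of_arcs: "T_of (arcs st) b = T_of E b - dom (startA st)"
  unfolding T_of_def arcs_eq by blast

lemma T_of_subset: "T_of E b \<subseteq> V1"
  using E_subset unfolding T_of_def by blast

lemma finite_T_of: "finite (T_of E b)"
  using T_of_subset finite_V1 finite_subset by blast

lemma finite_T_of_arcs: "finite (T_of (arcs st) b)"
  unfolding T_of_arcs using finite_T_of by blast

lemma finite_todo: "finite (todo st)"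
  using todo_subset finite_V2 finite_subset by blast

lemma finite_dom_A: "finite (dom (startA st))"
  using dom_A finite_V1 finite_subset by blast

lemma step1:
  assumes R: "R \<subseteq> todo st" "\<And>b. b \<in> R \<Longrightarrow> T_of (arcs st) b = {}"
    and step: "pd2_step1 R st st'"
  shows "pd2_invar V1 V2 E st'"
proof -
  obtain bs where bs: "distinct bs" "set bs = R"
    and st': "st' = st\<lparr>todo := todo st - R, free2 := free2 st + real (length bs),
      startB := consecutively (free2 st) bs (startB st)\<rparr>"
    using step unfolding pd2_step1_def lists_of_def by blast
  have new: "todo st' = todo st - R" "arcs st' = arcs st" "free1 st' = free1 st"
    "free2 st' = free2 st + real (length bs)" "startA st' = startA st"
    "startB st' = consecutively (free2 st) bs (startB st)"
    unfolding st' by simp_all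
  \<comment> \<open>An empty current predecessor set means that all original predecessors are
    scheduled; they end by \<open>free1 st\<close>, hence by \<open>free2 st\<close>.\<close>
  have R_done: "a \<in> dom (startA st)" if "(a, b) \<in> E" "b \<in> R" for a b
    using R(2)[OF that(2)] that(1) unfolding T_of_arcs unfolding T_of_def by blast
  show ?thesis
  proof (rule pd2_invar.intro, unfold new dom_consecutively bs(2))
    show "F2CD_instance V1 V2 E" by (rule instance_E)
    show "todo st - R \<subseteq> V2" using todo_subset by blast
    show "dom (startB st) \<union> R = V2 - (todo st - R)"
      unfolding dom_B using R(1) todo_subset by blast
    show "dom (startA st) \<subseteq> V1" by (rule dom_A)
    show "arcs st = {(a, b) \<in> E. a \<notin> dom (startA st)}" by (rule arcs_eq)
    show "a \<in> dom (startA st)" if "(a, b) \<in> E" "b \<notin> todo st - R" for a b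
      using that done_A R_done by blast
    show "free1 st = real (card (dom (startA st)))" by (rule free1_eq)
    show "packed (startA st) (free1 st)" by (rule packed_A)
    have "set bs \<inter> dom (startB st) = {}" unfolding dom_B bs(2) using R(1) by blast
    then show "packed (consecutively (free2 st) bs (startB st)) (free2 st + real (length bs))"
      using packed_B bs(1) by (intro packed_consecutively)
    show "free1 st \<le> free2 st + real (length bs)" using free1_le_free2 by simp
    show "the (startA st a) + 1 \<le> the (consecutively (free2 st) bs (startB st) b)"
      if "(a, b) \<in> E" "b \<in> dom (startB st) \<union> R" for a b
    proof (cases "b \<in> R")
      case True
      then have "the (startA st a) + 1 \<le> free1 st"
        using packed_A R_done[OF that(1)] unfolding packed_def by blast
      moreover have "free2 st \<le> the (consecutively (free2 st) bs (startB st) b)"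
        using consecutively_ge[OF bs(1)] bs(2) True by blast
      ultimately show ?thesis using free1_le_free2 by linarith
    next
      case False
      then show ?thesis using that precedence[OF that(1)] bs(2) by simp
    qed
  qed
qed

text \<open>The last claim carries the length estimate: M2 resumes when it is free or when M1 has
  finished the new batch, whichever is later.\<close>

lemma step2:
  assumes b: "b \<in> todo st" "T_of (arcs st) b \<noteq> {}" and step: "pd2_step2 E b st st'"
  shows "pd2_invar V1 V2 E st'"
    and "todo st' = todo st - {b}"
    and "free1 st' = free1 st + real (card (T_of (arcs st) b))"
    and "free2 st' \<le> max (free2 st) (free1 st') + 1"
proof -
  obtain as where as: "distinct as" "set as = T_of (arcs st) b"
    and "let sA = consecutively (free1 st) as (startA st);
            t = Max (insert (free2 st) ((\<lambda>a. the (sA a) + 1) ` T_of E b))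
        in st' = \<lparr> todo = todo st - {b}, arcs = {(a, b') \<in> arcs st. a \<notin> set as},
             free1 = free1 st + real (length as), free2 = t + 1, startA = sA,
             startB = (startB st)(b \<mapsto> t)\<rparr>"
    using step unfolding pd2_step2_def lists_of_def by blast
  then obtain sA t where sA: "sA = consecutively (free1 st) as (startA st)"
    and t: "t = Max (insert (free2 st) ((\<lambda>a. the (sA a) + 1) ` T_of E b))"
    and st': "st' = \<lparr>todo = todo st - {b}, arcs = {(a, b') \<in> arcs st. a \<notin> set as},
      free1 = free1 st + real (length as), free2 = t + 1, startA = sA,
      startB = (startB st)(b \<mapsto> t)\<rparr>"
    unfolding Let_def by blast
  have new: "todo st' = todo st - {b}" "arcs st' = {(a, b') \<in> arcs st. a \<notin> set as}"
    "free1 st' = free1 st + real (length as)" "free2 st' = t + 1" "startA st' = sA"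
    "startB st' = (startB st)(b \<mapsto> t)"
    unfolding st' by simp_all
  note T = T_of_arcs[of b]
  let ?X = "insert (free2 st) ((\<lambda>a. the (sA a) + 1) ` T_of E b)"
  have fin: "finite ?X" using finite_T_of by simp
  have dom_sA: "dom sA = dom (startA st) \<union> T_of E b"
    unfolding sA dom_consecutively as(2) T by blast
  have "set as \<inter> dom (startA st) = {}" unfolding as(2) T by blast
  then have packed_sA: "packed sA (free1 st + real (length as))"
    unfolding sA using packed_A as(1) by (intro packed_consecutively)
  have t_ge: "free2 st \<le> t" "\<And>a. a \<in> T_of E b \<Longrightarrow> the (sA a) + 1 \<le> t"
    unfolding t using fin by (auto intro: Max_ge)
  \<comment> \<open>Completions on M1, of old and new predecessors alike, are bounded by the new
    \<open>free1\<close>.\<close>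
  have "x \<le> max (free2 st) (free1 st + real (length as))" if x: "x \<in> ?X" for x
  proof (cases "x = free2 st")
    case False
    then obtain a where "a \<in> dom sA" "x = the (sA a) + 1" using x dom_sA by blast
    then have "x \<le> free1 st + real (length as)" using packed_sA unfolding packed_def by blast
    then show ?thesis by simp
  qed simp
  then have t_le: "t \<le> max (free2 st) (free1 st + real (length as))"
    unfolding t using fin by (intro Max.boundedI) auto
  have len: "length as = card (T_of (arcs st) b)" using distinct_card[OF as(1)] as(2) by simp
  show "todo st' = todo st - {b}" "free1 st' = free1 st + real (card (T_of (arcs st) b))"
    "free2 st' \<le> max (free2 st) (free1 st') + 1"
    unfolding new using len t_le by simp_all
  show "pd2_invar V1 V2 E st'"
  proof (rule pd2_invar.intro, unfold new)
    show "F2CD_instance V1 V2 E" by (rule instance_E)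
    show "todo st - {b} \<subseteq> V2" using todo_subset by blast
    show "dom ((startB st)(b \<mapsto> t)) = V2 - (todo st - {b})"
      using dom_B b(1) todo_subset by auto
    show "dom sA \<subseteq> V1" unfolding dom_sA using dom_A T_of_subset by blast
    show "{(a, b') \<in> arcs st. a \<notin> set as} = {(a, b) \<in> E. a \<notin> dom sA}"
      unfolding arcs_eq sA dom_consecutively by blast
    show "a \<in> dom sA" if "(a, b') \<in> E" "b' \<notin> todo st - {b}" for a b'
      using that done_A unfolding dom_sA T_of_def by blast
    have "card (dom sA) = card (dom (startA st)) + card (set as)"
      unfolding sA dom_consecutively using \<open>set as \<inter> dom (startA st) = {}\<close> finite_dom_A
      by (intro card_Un_disjoint) auto
    then show "free1 st + real (length as) = real (card (dom sA))"
      using free1_eq distinct_card[OF as(1)] by simp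
    show "packed sA (free1 st + real (length as))" by (rule packed_sA)
    have "b \<notin> dom (startB st)" unfolding dom_B using b(1) by blast
    then show "packed ((startB st)(b \<mapsto> t)) (t + 1)"
      using packed_update[OF packed_B _ t_ge(1)] by blast
    \<comment> \<open>As \<open>b\<close> is not ready, the batch is nonempty; its last operation
      ends exactly at the new \<open>free1\<close> and precedes \<open>b\<close>, so M2 does not
      become free before M1.\<close>
    have "as \<noteq> []" using as(2) b(2) by auto
    then have "the (sA (last as)) + 1 = free1 st + real (length as)"
      unfolding sA by (rule consecutively_last[OF as(1)])
    moreover have "last as \<in> T_of E b" using last_in_set[OF \<open>as \<noteq> []\<close>] unfolding as(2) T by blast
    ultimately show "free1 st + real (length as) \<le> t + 1" using t_ge(2)[of "last as"] by linarith
    show "the (sA a) + 1 \<le> the (((startB st)(b \<mapsto> t)) b')"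
      if "(a, b') \<in> E" "b' \<in> dom ((startB st)(b \<mapsto> t))" for a b'
    proof (cases "b' = b")
      case True
      then show ?thesis using t_ge(2)[of a] that(1) unfolding T_of_def by simp
    next
      case False
      then have b': "b' \<in> dom (startB st)" using that(2) by auto
      \<comment> \<open>All predecessors of an operation done earlier were scheduled earlier, so the
        new batch does not overwrite their start times.\<close>
      then have "b' \<notin> todo st" unfolding dom_B by blast
      then have "a \<notin> set as" using done_A[OF that(1)] unfolding as(2) T by blast
      then show ?thesis using precedence[OF that(1) b'] False unfolding sA by simp
    qed
  qed
qed

text \<open>Every A has a successor and every B is done, so \<open>done_A\<close> yields that every
  A was scheduled. M1 is free no later than M2, hence \<open>free2 st\<close> bounds both
  machines.\<close>

lemma final:
  assumes S: "\<forall>a\<in>V1. S_of E a \<noteq> {}" and fin: "todo st = {}"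
  shows "dom (startA st) = V1" "dom (startB st) = V2"
    and "feasible V1 V2 E (the \<circ> startA st) (the \<circ> startB st)"
    and "Cmax V1 V2 (the \<circ> startA st) (the \<circ> startB st) \<le> free2 st"
proof -
  show A: "dom (startA st) = V1"
  proof
    show "V1 \<subseteq> dom (startA st)"
      using S done_A unfolding S_of_def fin by blast
  qed (rule dom_A)
  show B: "dom (startB st) = V2" unfolding dom_B fin by blast
  have sA: "0 \<le> the (startA st a)" "the (startA st a) + 1 \<le> free2 st" if "a \<in> V1" for a
    using packed_A free1_le_free2 that unfolding packed_def A by fastforce+
  have sB: "0 \<le> the (startB st b)" "the (startB st b) + 1 \<le> free2 st" if "b \<in> V2" for b
    using packed_B that unfolding packed_def B by blast+
  have "no_overlap V1 (the \<circ> startA st)" "no_overlap V2 (the \<circ> startB st)"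
    using packed_A packed_B unfolding packed_def A B by blast+
  moreover have "the (startA st a) + 1 \<le> the (startB st b)" if "(a, b) \<in> E" for a b
    using precedence[OF that] that E_subset unfolding B by blast
  ultimately show "feasible V1 V2 E (the \<circ> startA st) (the \<circ> startB st)"
    using sA sB unfolding feasible_def by auto
  show "Cmax V1 V2 (the \<circ> startA st) (the \<circ> startB st) \<le> free2 st"
    using instance_E sA sB unfolding Cmax_def F2CD_instance_def by auto
qed

end

lemma pd2_invar_init:
  assumes "F2CD_instance V1 V2 E"
  shows "pd2_invar V1 V2 E (pd2_init V2 E)"
  using assms unfolding F2CD_instance_def
  by unfold_locales (auto simp: pd2_init_def packed_def no_overlap_def F2CD_instance_def)


section \<open>The length of the schedule\<close>

text \<open>Double count of the remaining arcs: two for each remaining A, at least \<open>d\<close>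
  for each remaining B. The operation \<open>b\<close> provides a remaining A, whose two successors
  show that at least two B remain.\<close>

lemma (in pd2_invar) min_degree_bound:
  assumes S: "\<forall>a\<in>V1. card (S_of E a) = 2"
    and d: "2 \<le> d" and b: "b \<in> todo st" "T_of (arcs st) b \<noteq> {}"
    and le: "\<And>b. b \<in> todo st \<Longrightarrow> d \<le> card (T_of (arcs st) b)"
  shows "free1 st + real d + real (card (todo st)) \<le> real (card V1) + 2"
proof -
  let ?A = "V1 - dom (startA st)"
  let ?R = "card (todo st)"
  have Ssub: "S_of E a \<subseteq> todo st" if "a \<in> ?A" for a
    using done_A that unfolding S_of_def by blast
  obtain a where a: "a \<in> ?A"
    using b(2) T_of_subset unfolding T_of_arcs by blast
  have R: "2 \<le> ?R"
    using card_mono[OF finite_todo Ssub[OF a]] S a by simp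
  have arcs_A: "arcs st = Sigma ?A (S_of E)"
    unfolding arcs_eq S_of_def using E_subset by blast
  \<comment> \<open>The same arcs grouped by their B, for the second count.\<close>
  have arcs_B: "arcs st = prod.swap ` Sigma (todo st) (T_of (arcs st))"
  proof
    show "arcs st \<subseteq> prod.swap ` Sigma (todo st) (T_of (arcs st))"
    proof
      fix x assume x: "x \<in> arcs st"
      obtain a b where ab: "x = (a, b)" by fastforce
      then have "a \<in> ?A" "b \<in> S_of E a" using x unfolding arcs_A by blast+
      then have "b \<in> todo st" using Ssub by blast
      moreover have "a \<in> T_of (arcs st) b" using x ab unfolding T_of_def by blast
      ultimately have "(b, a) \<in> Sigma (todo st) (T_of (arcs st))" by blast
      then show "x \<in> prod.swap ` Sigma (todo st) (T_of (arcs st))"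
        using ab by (force intro: rev_image_eqI)
    qed
    show "prod.swap ` Sigma (todo st) (T_of (arcs st)) \<subseteq> arcs st"
      unfolding T_of_def by auto
  qed
  have "card (arcs st) = (\<Sum>a\<in>?A. card (S_of E a))"
    unfolding arcs_A using finite_V1 finite_subset[OF Ssub finite_todo]
    by (intro card_SigmaI) blast+
  also have "\<dots> = 2 * card ?A" using S by simp
  finally have edges: "card (arcs st) = 2 * card ?A" .
  have "card (arcs st) = card (Sigma (todo st) (T_of (arcs st)))"
    by (subst arcs_B) (rule card_image, rule inj_swap)
  also have "\<dots> = (\<Sum>b\<in>todo st. card (T_of (arcs st) b))"
    using finite_todo finite_T_of_arcs by (intro card_SigmaI) blast+
  finally have "?R * d \<le> 2 * card ?A"
    using sum_bounded_below[of "todo st" d "\<lambda>b. card (T_of (arcs st) b)"] le edges by simp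
  then have "real ?R * real d \<le> 2 * real (card ?A)"
    by (metis of_nat_le_iff of_nat_mult of_nat_numeral)
  \<comment> \<open>Expanded: d R \<ge> 2 d + 2 R - 4. Together with d R \<le> 2 Q, where Q is
    \<open>card ?A\<close>, halving gives d + R \<le> Q + 2.\<close>
  moreover have "0 \<le> (real d - 2) * (real ?R - 2)" using d R by (intro mult_nonneg_nonneg) auto
  ultimately have "real d + real ?R \<le> real (card ?A) + 2" by (simp add: algebra_simps)
  moreover have "card V1 = card (dom (startA st)) + card ?A"
    using card_Diff_subset[OF finite_dom_A dom_A] card_mono[OF finite_V1 dom_A] by simp
  ultimately show ?thesis using free1_eq by simp
qed

text \<open>The first inequality bounds the finishing time if M2 never waits again; the second
  prepares for a vertex of degree 1. The initial state is exempt from the second because, with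
  isolated operations, \<open>card V2\<close> + 1 may exceed the bound.\<close>

definition pd2_bounded ::
  "'a set \<Rightarrow> 'b set \<Rightarrow> ('a \<times> 'b) set \<Rightarrow> ('a, 'b) pd2_state \<Rightarrow> bool" where
  "pd2_bounded V1 V2 E st \<longleftrightarrow>
     pd2_invar V1 V2 E st \<and>
     free2 st + real (card (todo st)) \<le> pd2_length_bound V1 V2 E \<and>
     (st = pd2_init V2 E \<or>
      free1 st + real (card (todo st)) + 1 \<le> pd2_length_bound V1 V2 E)"

lemma pd2_iteration_bounded:
  assumes S: "\<forall>a\<in>V1. card (S_of E a) = 2"
    and bnd: "pd2_bounded V1 V2 E st" and iter: "pd2_iteration E st st'"
  shows "pd2_bounded V1 V2 E st'" "todo st' \<subset> todo st"
proof -
  let ?L = "pd2_length_bound V1 V2 E"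
  let ?R = "{b \<in> todo st. T_of (arcs st) b = {}}"
  interpret pd2_invar V1 V2 E st using bnd unfolding pd2_bounded_def by blast
  obtain ls st1 where ls: "degree_ordering st ls"
    and "pd2_step1 (set (take (num_ready st) ls)) st st1"
    and step2: "if todo st1 = {} then st' = st1 else pd2_step2 E (ls ! num_ready st) st1 st'"
    and ne: "todo st \<noteq> {}"
    using iter unfolding pd2_iteration_def Let_def by blast
  then have st1: "pd2_step1 ?R st st1"
    unfolding degree_ordering_ready[OF ls finite_T_of_arcs] by blast
  interpret st1: pd2_invar V1 V2 E st1
    by (rule step1[OF _ _ st1]) blast+
  obtain bs where bs: "distinct bs" "set bs = ?R"
    and st1_eq: "st1 = st\<lparr>todo := todo st - ?R, free2 := free2 st + real (length bs),
      startB := consecutively (free2 st) bs (startB st)\<rparr>"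
    using st1 unfolding pd2_step1_def lists_of_def by blast
  have new: "todo st1 = todo st - ?R" "free1 st1 = free1 st" "arcs st1 = arcs st"
    "free2 st1 = free2 st + real (length bs)"
    unfolding st1_eq by simp_all
  have len: "length bs = card ?R" using distinct_card[OF bs(1)] bs(2) by simp
  have "?R \<subseteq> todo st" by blast
  then have card1: "card (todo st) = card (todo st1) + card ?R"
    unfolding new using card_Diff_subset[of ?R "todo st"] card_mono[OF finite_todo, of ?R]
      finite_subset[OF _ finite_todo, of ?R] by simp
  have free2: "free2 st1 + real (card (todo st1)) \<le> ?L"
    using bnd card1 len unfolding pd2_bounded_def new(4) by simp
  have free1: "free1 st1 + real (card (todo st1)) + 1 \<le> ?L"
  proof (cases "st = pd2_init V2 E")
    case False
    then have "free1 st + real (card (todo st)) + 1 \<le> ?L"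
      using bnd unfolding pd2_bounded_def by blast
    then show ?thesis using card1 unfolding new(2) by simp
  next
    case True
    then have init: "todo st = V2" "arcs st = E" "free1 st = 0" unfolding pd2_init_def by auto
    show ?thesis
    proof (cases "\<forall>b\<in>V2. T_of E b \<noteq> {}")
      case True
      then have "real (card V2) + 1 \<le> ?L" unfolding pd2_length_bound_def by simp
      then show ?thesis using card1 init(1,3) unfolding new(2) by simp
    next
      case False
      \<comment> \<open>An isolated B costs the bound its extra unit, but step 1 removes that B,
        which lowers the number of remaining operations by at least one.\<close>
      then have "?R \<noteq> {}" unfolding init by blast
      then have "card ?R > 0" using finite_todo by (simp add: card_gt_0_iff)
      moreover have "real (card V2) \<le> ?L"
        unfolding pd2_length_bound_def by (simp add: le_max_iff_disj)
      ultimately show ?thesis using card1 init(1,3) unfolding new(2) by simp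
    qed
  qed
  have "pd2_bounded V1 V2 E st' \<and> todo st' \<subset> todo st"
  proof (cases "todo st1 = {}")
    case True
    then have "st' = st1" using step2 by simp
    then show ?thesis
      using True ne st1.pd2_invar_axioms free1 free2 unfolding pd2_bounded_def by blast
  next
    case False
    define b where "b = ls ! num_ready st"
    have "\<not> todo st \<subseteq> ?R" using False unfolding new(1) by blast
    note nxt = degree_ordering_next[OF ls finite_T_of_arcs this, folded b_def]
    have b: "b \<in> todo st1" "T_of (arcs st1) b \<noteq> {}"
      unfolding new using nxt(1,2) by blast+
    have "pd2_step2 E b st1 st'" using step2 False unfolding b_def by simp
    note s2 = st1.step2[OF b this]
    let ?d = "card (T_of (arcs st1) b)"
    have "?d > 0" using b(2) st1.finite_T_of_arcs by (simp add: card_gt_0_iff)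
    have load: "free1 st1 + real ?d + real (card (todo st1)) \<le> ?L"
    proof (cases "?d = 1")
      case True
      then show ?thesis using free1 by simp
    next
      case False
      have "?d \<le> card (T_of (arcs st1) b')" if "b' \<in> todo st1" for b'
        using that nxt(3)[of b'] unfolding new by blast
      then have "free1 st1 + real ?d + real (card (todo st1)) \<le> real (card V1) + 2"
        using False \<open>?d > 0\<close> by (intro st1.min_degree_bound[OF S _ b]) auto
      then show ?thesis unfolding pd2_length_bound_def by simp
    qed
    have "card (todo st1) = Suc (card (todo st'))"
      unfolding s2(2) using card_Suc_Diff1[OF st1.finite_todo b(1)] by simp
    then have "free2 st' + real (card (todo st')) \<le> ?L"
      "free1 st' + real (card (todo st')) + 1 \<le> ?L"
      using s2(3,4) free2 load by linarith+
    moreover have "todo st' \<subset> todo st" unfolding s2(2) using b(1) new(1) by blast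
    ultimately show ?thesis using s2(1) unfolding pd2_bounded_def by blast
  qed
  then show "pd2_bounded V1 V2 E st'" "todo st' \<subset> todo st" by auto
qed

lemma pd2_bounded_init:
  assumes "F2CD_instance V1 V2 E"
  shows "pd2_bounded V1 V2 E (pd2_init V2 E)"
  using pd2_invar_init[OF assms] unfolding pd2_bounded_def pd2_length_bound_def
  by (simp add: pd2_init_def le_max_iff_disj)

lemma pd2_reachable_bounded:
  assumes "F2CD_instance V1 V2 E" "\<forall>a\<in>V1. card (S_of E a) = 2" "pd2_reachable V2 E st"
  shows "pd2_bounded V1 V2 E st"
  using assms(3) unfolding pd2_reachable_def
proof (induction rule: rtranclp_induct)
  case base
  show ?case by (rule pd2_bounded_init[OF assms(1)])
next
  case (step st st')
  show ?case by (rule pd2_iteration_bounded(1)[OF assms(2) step.IH step.hyps(2)])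
qed

section \<open>Progress, termination and optimality of every run\<close>

lemma (in pd2_invar) progress:
  assumes "todo st \<noteq> {}"
  shows "\<exists>st'. pd2_iteration E st st'"
proof -
  obtain ls where ls: "degree_ordering st ls" using ex_degree_ordering[OF finite_todo] by blast
  let ?R = "set (take (num_ready st) ls)"
  obtain bs where bs: "bs \<in> lists_of ?R" using lists_of_nonempty by blast
  define st1 where "st1 = st\<lparr>todo := todo st - ?R, free2 := free2 st + real (length bs),
    startB := consecutively (free2 st) bs (startB st)\<rparr>"
  have step1: "pd2_step1 ?R st st1" using bs unfolding pd2_step1_def st1_def by blast
  have "arcs st1 = arcs st" unfolding st1_def by simp
  then obtain as where "as \<in> lists_of (T_of (arcs st1) (ls ! num_ready st))"
    using lists_of_nonempty[OF finite_T_of_arcs] by auto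
  then have "\<exists>st'. pd2_step2 E (ls ! num_ready st) st1 st'"
    unfolding pd2_step2_def Let_def by blast
  then have "\<exists>st'. if todo st1 = {} then st' = st1 else pd2_step2 E (ls ! num_ready st) st1 st'"
    by (cases "todo st1 = {}") auto
  then show ?thesis using ls step1 assms unfolding pd2_iteration_def Let_def by blast
qed

theorem mainTheorem2:
  fixes V1 :: "'a set" and V2 :: "'b set" and E :: "('a \<times> 'b) set"
  assumes "F2CD_instance V1 V2 E"
    and "\<forall>a\<in>V1. card (S_of E a) = 2"
  shows "pd2_finds_optimal V1 V2 E"
  unfolding pd2_finds_optimal_def
proof (intro conjI allI impI)
  note reach = pd2_reachable_bounded[OF assms]
  have invar: "pd2_invar V1 V2 E st" if "pd2_bounded V1 V2 E st" for st
    using that unfolding pd2_bounded_def by blast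
  show "\<nexists>run. run 0 = pd2_init V2 E \<and> (\<forall>k. pd2_iteration E (run k) (run (Suc k)))"
  proof
    assume "\<exists>run. run 0 = pd2_init V2 E \<and> (\<forall>k. pd2_iteration E (run k) (run (Suc k)))"
    then obtain run where run: "run 0 = pd2_init V2 E"
      "\<And>k. pd2_iteration E (run k) (run (Suc k))" by blast
    have bnd: "pd2_bounded V1 V2 E (run k)" for k
    proof (induction k)
      case 0
      show ?case unfolding run(1) by (rule pd2_bounded_init[OF assms(1)])
    next
      case (Suc k)
      show ?case by (rule pd2_iteration_bounded(1)[OF assms(2) Suc run(2)])
    qed
    have "(card (todo (run (Suc k))), card (todo (run k))) \<in> less_than" for k
      using psubset_card_mono[OF pd2_invar.finite_todo[OF invar[OF bnd]]
        pd2_iteration_bounded(2)[OF assms(2) bnd run(2)]] by simp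
    then have "\<exists>f. \<forall>k. (f (Suc k), f k) \<in> less_than"
      by (intro exI[of _ "\<lambda>k. card (todo (run k))"]) blast
    then show False using wf_less_than unfolding wf_iff_no_infinite_down_chain by blast
  qed
  fix st
  show "\<exists>st'. pd2_iteration E st st'" if "pd2_reachable V2 E st \<and> todo st \<noteq> {}"
    using pd2_invar.progress[OF invar[OF reach]] that by blast
  assume st: "pd2_reachable V2 E st \<and> todo st = {}"
  then have bnd: "pd2_bounded V1 V2 E st" using reach by blast
  have len: "free2 st \<le> pd2_length_bound V1 V2 E"
    using bnd st unfolding pd2_bounded_def by simp
  have "\<forall>a\<in>V1. S_of E a \<noteq> {}" using assms(2) by fastforce
  note final = pd2_invar.final[OF invar[OF bnd] this conjunct2[OF st]]
  show "dom (startA st) = V1" "dom (startB st) = V2" by (fact final)+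
  \<comment> \<open>The length is at most \<open>free2 st\<close>, which is at most the common lower
    bound of all feasible schedules.\<close>
  show "optimal V1 V2 E (the \<circ> startA st) (the \<circ> startB st)"
    unfolding optimal_def
    using final(3) order_trans[OF order_trans[OF final(4) len] Cmax_ge_pd2_length_bound[OF assms]]
    by blast
qed

end
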